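(* Let $n\ge 0$ be an integer, let $s\in\mathbb{C}$, let $a\in\mathbb{C}$ with $\Re(a)>0$, and put $q=\frac{a}{4}+\frac14$ (so $2q=\frac{a+1}{2}$). Then $$\int_{0}^{\infty}\frac{v^{2n+1}\,\sin\!\left(s\arctan\!\left(\frac{2v}{a}\right)\right)}{(a^{2}+4v^{2})^{s/2}\cosh(\pi v)}\,dv=\frac{(-1)^{n+1}\,(a/2)^{2n+1}\,\Gamma(2n+2)}{2^{s}}\sum_{j=0}^{2n+1}\frac{(-2/a)^{j}\,\eta(s-j,2q)}{\Gamma(2n-j+2)\,\Gamma(j+1)} .$$
   Context: $\eta(s,x)$ is the alternating Hurwitz zeta function, $\eta(s,x)=\sum_{k=0}^{\infty}\frac{(-1)^k}{(k+x)^s}$ for $\Re(x)>0$ (convergent for $\Re(s)>0$), extended to all $s\in\mathbb{C}$ by analytic continuation in $s$ (it is entire in $s$). All powers and $\arctan$ take their principal values. *)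

theory Defs
  imports "HOL-Complex_Analysis.Complex_Analysis"
begin

(* The defining predicate is meant for Re x > 0. The entire function is then unique by the
   identity theorem, since it is prescribed on the half-plane Re s > 0. The series is only
   conditionally convergent for 0 < Re s <= 1, hence "sums" rather than an unordered sum. *)
definition alt_hurwitz_zeta :: "complex \<Rightarrow> complex \<Rightarrow> complex" where
  "alt_hurwitz_zeta s x =
     (THE f. f holomorphic_on UNIV \<and>
        (\<forall>z. Re z > 0 \<longrightarrow> (\<lambda>k. (-1) ^ k / (of_nat k + x) powr z) sums f z)) s"

end

theory Submission
  imports Defs "HOL-Real_Asymp.Real_Asymp"
begin

text \<open>
  Write \<open>b = a/2\<close>, so that \<open>2q = b + 1/2\<close>. The sine over the power of \<open>a\<^sup>2 + 4v\<^sup>2\<close> is, up to the factor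
  \<open>2i 2\<^sup>s\<close>, the difference of \<open>(b - iv)\<^sup>-\<^sup>s\<close> and \<open>(b + iv)\<^sup>-\<^sup>s\<close> (\<open>sin_Arctan_over_powr\<close>); the principal branches
  agree because both \<open>b \<plusminus> iv\<close> lie in the right half-plane. The theorem therefore concerns integrals of powers
  along the line \<open>Re w = Re b\<close> against \<open>1/cosh (\<pi>v)\<close>.

  The central fact (\<open>alt_hurwitz_zeta_eq_sech_mean\<close>) is the case without a power of \<open>v\<close>:
  \<open>\<eta>(s, b + 1/2)\<close> equals half the integral over \<open>v \<ge> 0\<close> of
  \<open>((b + iv)\<^sup>-\<^sup>s + (b - iv)\<^sup>-\<^sup>s) / cosh (\<pi>v)\<close>, for every complex \<open>s\<close>. This mean of a function \<open>g\<close> over a vertical line,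
  \<open>sech_mean g b\<close>, satisfies \<open>sech_mean g b + sech_mean g (b + 1) = g (b + 1/2)\<close> (\<open>sech_mean_shift\<close>): on the two
  sides of the strip \<open>|Re u| \<le> 1/2\<close> the function \<open>sin (\<pi>u)\<close> takes the values \<open>\<plusminus>cosh (\<pi>v)\<close>, so the left-hand side is a
  contour integral of \<open>g (b + 1/2 + u) / sin (\<pi>u)\<close>, whose only pole in the strip is \<open>u = 0\<close>. Iterating the
  equation produces the partial sums of the alternating series, with an error \<open>sech_mean g (b + n)\<close> that vanishes
  when \<open>g\<close> tends to 0 to the right. For \<open>g w = w\<^sup>-\<^sup>s\<close> with \<open>Re s > 0\<close> the mean is thus the series that defines
  \<open>\<eta>\<close>. The mean is moreover entire in \<open>s\<close>, because \<open>1/cosh (\<pi>v)\<close> beats any power, so it is the continuation of \<open>\<eta>\<close>.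

  Now no continuation or contour shift is left to do: substituting this representation for each
  \<open>\<eta>(s - j, 2q)\<close>, the sum over \<open>j\<close> under the integral is the binomial expansion of
  \<open>(1 - w/b)\<^sup>2\<^sup>n\<^sup>+\<^sup>1\<close> at \<open>w = b \<plusminus> iv\<close>, that is, of \<open>(\<mp>iv/b)\<^sup>2\<^sup>n\<^sup>+\<^sup>1\<close>. The odd exponent turns the sum of the two terms
  \<open>w = b \<plusminus> iv\<close> into the difference that makes up the sine.
\<close>

section \<open>Exponentially decaying integrands on a half-line\<close>

text \<open>The explicit tail bound serves twice: it identifies the limits of truncated integrals, and, as it depends on
  the integrand only through \<open>K\<close>, it makes their convergence uniform in a parameter.\<close>

lemma exp_decay_integral:
  fixes f :: "real \<Rightarrow> complex"
  assumes cont: "continuous_on {0..} f"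
    and bd: "\<And>v. v \<ge> 0 \<Longrightarrow> norm (f v) \<le> K * exp (- v)"
    and T: "T \<ge> 0"
  shows exp_decay_integrable: "f integrable_on {0..}"
    and exp_decay_integral_tail: "norm (integral {0..} f - integral {0..T} f) \<le> K * exp (- T)"
proof -
  have maj: "((\<lambda>v. K * exp (- v)) has_integral K * exp (- c)) {c..}" for c :: real
    using has_integral_mult_right[OF has_integral_exp_minus_to_infinity[of 1 c], of K] by simp
  have int: "f integrable_on {c..}" if "c \<ge> 0" for c
  proof (rule measurable_bounded_by_integrable_imp_integrable)
    have "continuous_on {c..} f"
      using cont by (rule continuous_on_subset) (use that in auto)
    then show "f \<in> borel_measurable (lebesgue_on {c..})"
      by (rule continuous_imp_measurable_on_sets_lebesgue) auto
    show "(\<lambda>v. K * exp (- v)) integrable_on {c..}"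
      using maj by blast
    show "norm (f v) \<le> K * exp (- v)" if "v \<in> {c..}" for v
      using that \<open>c \<ge> 0\<close> by (intro bd) auto
  qed auto
  show "f integrable_on {0..}"
    by (rule int) simp
  have "integral ({0..T} \<union> {T..}) f = integral {0..T} f + integral {T..} f"
  proof (rule integral_Un)
    show "f integrable_on {0..T}"
      by (intro integrable_continuous_interval continuous_on_subset[OF cont]) auto
    show "negligible ({0..T} \<inter> {T..})"
      by (rule negligible_subset[of "{T}"]) auto
  qed (use int T in auto)
  moreover have "{0..T} \<union> {T..} = {0..}"
    using T by auto
  ultimately have "integral {0..} f - integral {0..T} f = integral {T..} f"
    by simp
  also have "norm \<dots> \<le> integral {T..} (\<lambda>v. K * exp (- v))"
    using T maj
    by (intro Henstock_Kurzweil_Integration.integral_norm_bound_integral int bd) auto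
  also have "\<dots> = K * exp (- T)"
    using maj by (rule integral_unique)
  finally show "norm (integral {0..} f - integral {0..T} f) \<le> K * exp (- T)" .
qed

lemma integral_symmetric_interval:
  fixes f :: "real \<Rightarrow> complex"
  assumes cont: "continuous_on {-T..T} f" and T: "T \<ge> 0"
  shows "integral {-T..T} f = integral {0..T} (\<lambda>v. f v + f (- v))"
proof -
  have int: "f integrable_on {-T..T}"
    using cont by (rule integrable_continuous_interval)
  have int1: "f integrable_on {-T..0}" "f integrable_on {0..T}"
    using T by (auto intro!: integrable_subinterval_real[OF int])
  have "integral {-T..T} f = integral {-T..0} f + integral {0..T} f"
    using Henstock_Kurzweil_Integration.integral_combine[of "-T" 0 T f] T int by simp
  also have "integral {-T..0} f = integral {0..T} (\<lambda>v. f (- v))"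
    using Henstock_Kurzweil_Integration.integral_reflect_real[where a = "-T" and b = 0 and f = f] by simp
  also have "\<dots> + integral {0..T} f = integral {0..T} (\<lambda>v. f v + f (- v))"
    using int1 Henstock_Kurzweil_Integration.integrable_reflect_real[where a = "-T" and b = 0 and f = f]
    by (subst Henstock_Kurzweil_Integration.integral_add) (simp_all add: add.commute)
  finally show ?thesis .
qed

section \<open>The hyperbolic secant mean of a function\<close>

text \<open>The integral of \<open>g (b + iv) / cosh (\<pi>v)\<close> over the real line is folded onto \<open>v \<ge> 0\<close>, since the integral to be
  evaluated lives on that half-line.\<close>

definition sech_integrand :: "(complex \<Rightarrow> complex) \<Rightarrow> complex \<Rightarrow> real \<Rightarrow> complex" where
  "sech_integrand g b v = (g (b + \<i> * of_real v) + g (b - \<i> * of_real v)) / of_real (cosh (pi * v))"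

definition sech_mean :: "(complex \<Rightarrow> complex) \<Rightarrow> complex \<Rightarrow> complex" where
  "sech_mean g b = integral {0..} (sech_integrand g b) / 2"

lemma exp_le_cosh_pi:
  assumes "v \<ge> 0"
  shows "exp (3 * v) \<le> 2 * cosh (pi * v)"
proof -
  have "3 * v \<le> pi * v"
    using assms pi_gt3 by (intro mult_right_mono) auto
  then have "exp (3 * v) \<le> exp (pi * v)"
    by simp
  also have "\<dots> \<le> 2 * cosh (pi * v)"
    by (simp add: cosh_def)
  finally show ?thesis .
qed

text \<open>Since \<open>\<pi> > 3\<close>, growth of rate 2 along the line still leaves a decay of rate 1.\<close>

lemma norm_sech_integrand_le:
  assumes v: "v \<ge> 0"
    and "norm (g (b + \<i> * of_real v)) \<le> K * exp (2 * v)"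
    and "norm (g (b - \<i> * of_real v)) \<le> K * exp (2 * v)"
  shows "norm (sech_integrand g b v) \<le> 4 * K * exp (- v)"
proof -
  have K: "0 \<le> K"
    using assms(2) norm_ge_zero[of "g (b + \<i> * of_real v)"] order_trans zero_le_mult_iff[of K "exp (2 * v)"]
      exp_gt_zero[of "2 * v"] by (metis leD)
  have "norm (sech_integrand g b v) = norm (g (b + \<i> * of_real v) + g (b - \<i> * of_real v)) / cosh (pi * v)"
    by (simp add: sech_integrand_def norm_divide)
  also have "\<dots> \<le> (2 * K * exp (2 * v)) / (exp (3 * v) / 2)"
  proof (rule frac_le)
    show "norm (g (b + \<i> * of_real v) + g (b - \<i> * of_real v)) \<le> 2 * K * exp (2 * v)"
      using assms by (intro norm_triangle_le) simp
  qed (use exp_le_cosh_pi[OF v] K in auto)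
  also have "\<dots> = 4 * K * exp (- v)"
    by (simp add: field_simps flip: exp_add)
  finally show ?thesis .
qed

lemma continuous_on_sech_integrand:
  assumes g: "continuous_on {w. Re w > 0} g" and b: "Re b > 0"
  shows "continuous_on S (sech_integrand g b)"
proof -
  have "continuous_on S (\<lambda>v. g (b + \<i> * of_real v))" "continuous_on S (\<lambda>v. g (b - \<i> * of_real v))"
    using b by (auto intro!: continuous_on_compose2[OF g] continuous_intros)
  then show ?thesis
    unfolding sech_integrand_def
    by (intro continuous_intros) auto
qed

lemma sech_integrand_integrable:
  assumes g: "continuous_on {w. Re w > 0} g" and b: "Re b > 0"
    and bd: "\<And>w. Re w = Re b \<Longrightarrow> norm (g w) \<le> K * exp (2 * norm (w - b))"
  shows "sech_integrand g b integrable_on {0..}"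
    and "T \<ge> 0 \<Longrightarrow> norm (integral {0..} (sech_integrand g b) - integral {0..T} (sech_integrand g b))
           \<le> 4 * K * exp (- T)"
proof -
  have "norm (sech_integrand g b v) \<le> 4 * K * exp (- v)" if "v \<ge> 0" for v
    using bd[of "b + \<i> * of_real v"] bd[of "b - \<i> * of_real v"] that
    by (intro norm_sech_integrand_le) (auto simp: norm_mult)
  note * = exp_decay_integral[OF continuous_on_sech_integrand[OF g b] this]
  show "sech_integrand g b integrable_on {0..}"
    by (rule *(1)[of 0]) auto
  show "norm (integral {0..} (sech_integrand g b) - integral {0..T} (sech_integrand g b))
           \<le> 4 * K * exp (- T)" if "T \<ge> 0"
    using that by (intro *(2)) auto
qed

lemma norm_sech_mean_le:
  assumes g: "continuous_on {w. Re w > 0} g" and b: "Re b > 0"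
    and bd: "\<And>w. Re w = Re b \<Longrightarrow> norm (g w) \<le> K"
  shows "norm (sech_mean g b) \<le> 2 * K"
proof -
  have "0 \<le> K"
    using bd[of b] order_trans[OF norm_ge_zero] by auto
  then have "norm (g w) \<le> K * exp (2 * norm (w - b))" if "Re w = Re b" for w
    using bd[OF that] mult_left_mono[of 1 "exp (2 * norm (w - b))" K] by simp
  from sech_integrand_integrable(2)[OF g b this, of 0] show ?thesis
    by (simp add: sech_mean_def norm_divide)
qed

section \<open>The shift equation\<close>

lemma sin_pi_times_eq_0_iff:
  assumes "\<bar>Re u\<bar> < 1"
  shows "sin (of_real pi * u) = 0 \<longleftrightarrow> u = 0"
proof
  assume "sin (of_real pi * u) = 0"
  then obtain n :: int where "of_real pi * u = of_real (of_int n * pi)"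
    by (auto simp: sin_eq_0)
  then have "u = of_int n"
    by simp
  with assms show "u = 0"
    by simp
qed simp

text \<open>This makes \<open>1/sin (\<pi>u)\<close> small on the horizontal sides of a tall rectangle.\<close>

lemma norm_sin_ge_sinh: "sinh \<bar>Im z\<bar> \<le> norm (sin z)"
proof -
  have "norm (sin z) = norm (exp (\<i> * z) - exp (- (\<i> * z))) / 2"
    by (simp add: sin_exp_eq norm_divide norm_mult)
  moreover have "\<bar>norm (exp (\<i> * z)) - norm (exp (- (\<i> * z)))\<bar> \<le> norm (exp (\<i> * z) - exp (- (\<i> * z)))"
    by (rule norm_triangle_ineq3)
  ultimately show ?thesis
    by (auto simp: sinh_def norm_exp_eq_Re abs_if split: if_splits)
qed

lemma cosh_complex_of_real: "cosh (complex_of_real x) = of_real (cosh x)"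
  by (simp add: cosh_def scaleR_conv_of_real flip: exp_of_real)

text \<open>The opposite signs on the two sides of the strip cancel against the opposite orientations of these sides in
  the boundary of a rectangle, so that the two means are added rather than subtracted.\<close>

lemma sin_pi_half_plus:
  "sin (of_real pi * Complex (1/2) v) = of_real (cosh (pi * v))"
  "sin (of_real pi * Complex (- 1/2) v) = - of_real (cosh (pi * v))"
proof -
  have "sin (of_real pi * Complex (1/2) v) = sin (of_real pi / 2 + \<i> * of_real (pi * v))"
    by (simp add: Complex_eq algebra_simps)
  also have "\<dots> = of_real (cosh (pi * v))"
    by (simp only: sin_add flip: cosh_conv_cos cosh_complex_of_real) simp
  finally show "sin (of_real pi * Complex (1/2) v) = of_real (cosh (pi * v))" .
  have "sin (of_real pi * Complex (- 1/2) v) = sin (- (of_real pi / 2) + \<i> * of_real (pi * v))"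
    by (simp add: Complex_eq algebra_simps)
  also have "\<dots> = - of_real (cosh (pi * v))"
    by (simp only: sin_add flip: cosh_conv_cos cosh_complex_of_real) simp
  finally show "sin (of_real pi * Complex (- 1/2) v) = - of_real (cosh (pi * v))" .
qed

lemma residue_over_sin_pi:
  assumes h: "h holomorphic_on S" and S: "open S" "0 \<in> S" "S \<subseteq> {u. \<bar>Re u\<bar> < 1}"
  shows "residue (\<lambda>u. h u / sin (of_real pi * u)) 0 = h 0 / of_real pi"
proof (rule residue_simple'[OF S(1,2)])
  show "(\<lambda>u. h u / sin (of_real pi * u)) holomorphic_on S - {0}"
    using S sin_pi_times_eq_0_iff
    by (auto intro!: holomorphic_intros holomorphic_on_subset[OF h])
  have "((\<lambda>u. sin (of_real pi * u)) has_field_derivative of_real pi) (at 0)"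
    by (auto intro!: derivative_eq_intros)
  then have "((\<lambda>u::complex. sin (of_real pi * u) / u) \<longlongrightarrow> of_real pi) (at 0)"
    by (simp add: has_field_derivative_iff)
  moreover have "(h \<longlongrightarrow> h 0) (at 0)"
    using holomorphic_on_imp_continuous_on[OF h] S
    by (metis continuous_on_eq_continuous_at isContD)
  ultimately have "((\<lambda>u. h u / (sin (of_real pi * u) / u)) \<longlongrightarrow> h 0 / of_real pi) (at 0)"
    by (intro tendsto_divide) auto
  then show "((\<lambda>u. h u / sin (of_real pi * u) * (u - 0)) \<longlongrightarrow> h 0 / of_real pi) (at 0)"
    by simp
qed

text \<open>The residue theorem for \<open>g (b + 1/2 + u) / sin (\<pi>u)\<close> on the boundary of the rectangle with vertices \<open>\<plusminus>1/2 \<plusminus> iT\<close>: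
  the vertical sides give the two truncated means, the residue at 0 gives the value of \<open>g\<close>, and the bound is the
  contribution of the two horizontal sides, which have length 1.\<close>

lemma sech_rectangle_bound:
  assumes g: "g holomorphic_on {w. Re w > 0}" and b: "Re b > 0"
    and bd: "\<And>w. Re w \<ge> Re b \<Longrightarrow> norm (g w) \<le> K" and T: "T > 0"
  shows "norm (integral {0..T} (sech_integrand g b) + integral {0..T} (sech_integrand g (b + 1))
               - 2 * g (b + 1/2)) \<le> 2 * K / sinh (pi * T)"
proof -
  define x where "x = b + 1/2"
  \<comment> \<open>The first condition keeps \<open>x + u\<close> in the domain of \<open>g\<close>, the others exclude the zeros \<open>\<plusminus>1\<close> of the sine.\<close>
  define S where "S = {u. - Re x < Re u \<and> -1 < Re u \<and> Re u < 1}"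
  define f where "f = (\<lambda>u. g (x + u) / sin (of_real pi * u))"
  define a1 a2 a3 a4 where
    "a1 = Complex (-1/2) (-T)" and "a2 = Complex (1/2) (-T)" and
    "a3 = Complex (1/2) T" and "a4 = Complex (-1/2) T"
  note a_defs = a1_def a2_def a3_def a4_def
  have S_eq: "S = {u. - Re x < Re u} \<inter> {u. -1 < Re u} \<inter> {u. Re u < 1}"
    by (auto simp: S_def)
  have S: "open S" "convex S"
    unfolding S_eq
    by (intro open_Int open_halfspace_Re_gt open_halfspace_Re_lt
          convex_Int convex_halfspace_Re_gt convex_halfspace_Re_lt)+
  have x: "Re x > 1/2"
    using b by (simp add: x_def)
  have holg: "(\<lambda>u. g (x + u)) holomorphic_on S"
    by (rule holomorphic_on_compose_gen[OF _ g, unfolded o_def]) (auto intro!: holomorphic_intros simp: S_def)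
  have holf: "f holomorphic_on S - {0}"
    unfolding f_def using sin_pi_times_eq_0_iff
    by (auto intro!: holomorphic_intros holomorphic_on_subset[OF holg] simp: S_def)
  have box: "cbox a1 a3 \<subseteq> S"
    using x by (auto simp: in_cbox_complex_iff a_defs S_def)
  have zero_in: "0 \<in> box a1 a3"
    using T by (auto simp: in_box_complex_iff a_defs)
  have img: "path_image (rectpath a1 a3) \<subseteq> S - {0}"
    using box zero_in T by (auto simp: path_image_rectpath_cbox_minus_box a_defs)
  have img_eq: "path_image (rectpath a1 a3) =
      closed_segment a1 a2 \<union> closed_segment a2 a3 \<union> closed_segment a3 a4 \<union> closed_segment a4 a1"
    by (simp add: rectpath_def Let_def path_image_join a_defs Un_assoc)
  have contf: "continuous_on (path_image (rectpath a1 a3)) f"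
    using holomorphic_on_imp_continuous_on[OF holf] img by (rule continuous_on_subset)
  have cint: "f contour_integrable_on (linepath a1 a2)" "f contour_integrable_on (linepath a2 a3)"
      "f contour_integrable_on (linepath a3 a4)" "f contour_integrable_on (linepath a4 a1)"
    by (intro contour_integrable_continuous_linepath continuous_on_subset[OF contf]; auto simp: img_eq)+
  have "contour_integral (rectpath a1 a3) f
      = 2 * pi * \<i> * (\<Sum>p\<in>{0}. winding_number (rectpath a1 a3) p * residue f p)"
  proof (rule Residue_theorem[OF S(1) convex_connected[OF S(2)]])
    show "\<forall>z. z \<notin> S \<longrightarrow> winding_number (rectpath a1 a3) z = 0"
      using box T by (auto intro!: winding_number_rectpath_outside simp: a_defs)
  qed (use holf img in auto)
  moreover have "residue f 0 = g x / of_real pi"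
  proof -
    have "0 \<in> S" "S \<subseteq> {u. \<bar>Re u\<bar> < 1}"
      using x by (auto simp: S_def)
    from residue_over_sin_pi[OF holg S(1) this] show ?thesis
      by (simp add: f_def)
  qed
  ultimately have res: "contour_integral (rectpath a1 a3) f = 2 * \<i> * g x"
    using winding_number_rectpath[OF zero_in] by simp
  have right: "contour_integral (linepath a2 a3) f
      = \<i> * integral {-T..T} (\<lambda>v. g (b + 1 + \<i> * of_real v) / of_real (cosh (pi * v)))"
  proof -
    have "f (Complex (1/2) v) = g (b + 1 + \<i> * of_real v) / of_real (cosh (pi * v))" for v
      unfolding f_def sin_pi_half_plus by (simp add: x_def Complex_eq add_ac)
    then show ?thesis
      using contour_integral_linepath_same_Re[of a2 "1/2" a3 "-T" T f] T by (simp add: a_defs)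
  qed
  have left: "contour_integral (linepath a4 a1) f
      = \<i> * integral {-T..T} (\<lambda>v. g (b + \<i> * of_real v) / of_real (cosh (pi * v)))"
  proof -
    have "f (Complex (-1/2) v) = - (g (b + \<i> * of_real v) / of_real (cosh (pi * v)))" for v
      unfolding f_def sin_pi_half_plus by (simp add: x_def Complex_eq add_ac)
    then have "contour_integral (linepath a1 a4) f
        = - (\<i> * integral {-T..T} (\<lambda>v. g (b + \<i> * of_real v) / of_real (cosh (pi * v))))"
      using contour_integral_linepath_same_Re[of a1 "-1/2" a4 "-T" T f] T by (simp add: a_defs)
    moreover have "contour_integral (linepath a4 a1) f = - contour_integral (linepath a1 a4) f"
      using contour_integral_reversepath[of "linepath a1 a4" f] by simp
    ultimately show ?thesis
      by simp
  qed
  have contg: "continuous_on {-T..T} (\<lambda>v. g (c + \<i> * of_real v) / of_real (cosh (pi * v)))"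
    if "Re c > 0" for c
    using that
    by (intro continuous_intros continuous_on_compose2[OF holomorphic_on_imp_continuous_on[OF g]])
       auto
  have sides: "contour_integral (linepath a2 a3) f + contour_integral (linepath a4 a1) f
      = \<i> * (integral {0..T} (sech_integrand g b) + integral {0..T} (sech_integrand g (b + 1)))"
    unfolding left right
    using integral_symmetric_interval[OF contg[of b]] integral_symmetric_interval[OF contg[of "b + 1"]] b T
    by (simp add: sech_integrand_def[abs_def] add_divide_distrib algebra_simps)
  have horiz: "norm (f u) \<le> K / sinh (pi * T)" if "\<bar>Im u\<bar> = T" "\<bar>Re u\<bar> \<le> 1/2" for u
  proof -
    have "norm (g (x + u)) \<le> K"
      using that by (intro bd) (auto simp: x_def)
    moreover have "sinh (pi * T) \<le> norm (sin (of_real pi * u))"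
      using norm_sin_ge_sinh[of "of_real pi * u"] that T by (auto simp: abs_mult)
    moreover have "0 \<le> K"
      using bd[of b] order_trans[OF norm_ge_zero] by auto
    ultimately show ?thesis
      unfolding f_def norm_divide using T by (intro frac_le) auto
  qed
  have K: "0 \<le> K / sinh (pi * T)"
    using horiz[of "Complex 0 T"] T order_trans[OF norm_ge_zero] by auto
  have "norm (contour_integral (linepath a1 a2) f) \<le> K / sinh (pi * T) * norm (a2 - a1)"
    using T by (intro contour_integral_bound_linepath cint K horiz)
      (auto simp: closed_segment_same_Im a_defs closed_segment_eq_real_ivl)
  moreover have "norm (contour_integral (linepath a3 a4) f) \<le> K / sinh (pi * T) * norm (a4 - a3)"
    using T by (intro contour_integral_bound_linepath cint K horiz)
      (auto simp: closed_segment_same_Im a_defs closed_segment_eq_real_ivl)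
  moreover have "norm (a2 - a1) = 1" "norm (a4 - a3) = 1"
    by (simp_all add: a_defs complex_norm complex_diff)
  ultimately have hor: "norm (contour_integral (linepath a1 a2) f + contour_integral (linepath a3 a4) f)
      \<le> 2 * K / sinh (pi * T)"
    by (intro norm_triangle_le) simp
  have "contour_integral (rectpath a1 a3) f = contour_integral (linepath a1 a2) f +
      (contour_integral (linepath a2 a3) f +
      (contour_integral (linepath a3 a4) f + contour_integral (linepath a4 a1) f))"
    using cint by (simp add: rectpath_def Let_def contour_integral_join contour_integrable_join a_defs)
  with res have "2 * \<i> * g x = contour_integral (linepath a1 a2) f + contour_integral (linepath a3 a4) f +
      (contour_integral (linepath a2 a3) f + contour_integral (linepath a4 a1) f)"
    by (simp add: add_ac)
  then have "\<i> * (integral {0..T} (sech_integrand g b) + integral {0..T} (sech_integrand g (b + 1)) - 2 * g x)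
      = - (contour_integral (linepath a1 a2) f + contour_integral (linepath a3 a4) f)"
    unfolding sides by (simp add: algebra_simps)
  then have "norm (\<i> * (integral {0..T} (sech_integrand g b) + integral {0..T} (sech_integrand g (b + 1))
      - 2 * g x)) \<le> 2 * K / sinh (pi * T)"
    using hor by (simp only: norm_minus_cancel)
  then show ?thesis
    by (simp add: norm_mult x_def)
qed

lemma sech_mean_shift:
  assumes g: "g holomorphic_on {w. Re w > 0}" and b: "Re b > 0"
    and bd: "\<And>w. Re w \<ge> Re b \<Longrightarrow> norm (g w) \<le> K"
  shows "sech_mean g b + sech_mean g (b + 1) = g (b + 1/2)"
proof -
  have K: "0 \<le> K"
    using bd[of b] order_trans[OF norm_ge_zero] by auto
  have cont: "continuous_on {w. Re w > 0} g"
    using g by (rule holomorphic_on_imp_continuous_on)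
  have lim: "(\<lambda>n. integral {0..real n} (sech_integrand g c)) \<longlonglongrightarrow> integral {0..} (sech_integrand g c)"
    if c: "Re c \<ge> Re b" for c
  proof -
    have "norm (g w) \<le> K * exp (2 * norm (w - c))" if "Re w = Re c" for w
      using bd[of w] mult_left_mono[of 1 "exp (2 * norm (w - c))" K] K that c by simp
    from sech_integrand_integrable(2)[OF cont _ this]
    have "norm (integral {0..} (sech_integrand g c) - integral {0..real n} (sech_integrand g c))
            \<le> 4 * K * exp (- real n)" for n
      using b c by simp
    then have "\<forall>\<^sub>F n in sequentially. norm (integral {0..} (sech_integrand g c)
        - integral {0..real n} (sech_integrand g c)) \<le> 4 * K * exp (- real n)"
      by simp
    moreover have "(\<lambda>n. 4 * K * exp (- real n)) \<longlonglongrightarrow> 0"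
      by real_asymp
    ultimately have "(\<lambda>n. integral {0..} (sech_integrand g c) - integral {0..real n} (sech_integrand g c)) \<longlonglongrightarrow> 0"
      by (rule Lim_null_comparison)
    from tendsto_diff[OF tendsto_const this, of "integral {0..} (sech_integrand g c)"] show ?thesis
      by simp
  qed
  have "(\<lambda>n. integral {0..real n} (sech_integrand g b) + integral {0..real n} (sech_integrand g (b + 1))
      - 2 * g (b + 1/2)) \<longlonglongrightarrow> 0"
  proof (rule Lim_null_comparison)
    show "\<forall>\<^sub>F n in sequentially. norm (integral {0..real n} (sech_integrand g b)
        + integral {0..real n} (sech_integrand g (b + 1)) - 2 * g (b + 1/2)) \<le> 2 * K / sinh (pi * real n)"
      using eventually_gt_at_top[of 0]
      by eventually_elim (rule sech_rectangle_bound[OF g b bd], auto)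
    show "(\<lambda>n. 2 * K / sinh (pi * real n)) \<longlonglongrightarrow> 0"
      by real_asymp
  qed
  moreover have "(\<lambda>n. integral {0..real n} (sech_integrand g b) + integral {0..real n} (sech_integrand g (b + 1))
      - 2 * g (b + 1/2)) \<longlonglongrightarrow>
      integral {0..} (sech_integrand g b) + integral {0..} (sech_integrand g (b + 1)) - 2 * g (b + 1/2)"
    by (intro tendsto_intros lim) auto
  ultimately have "integral {0..} (sech_integrand g b) + integral {0..} (sech_integrand g (b + 1))
      - 2 * g (b + 1/2) = 0"
    using LIMSEQ_unique by blast
  then show ?thesis
    by (simp add: sech_mean_def field_simps)
qed

text \<open>The shift equation telescopes: the \<open>n\<close>-th partial sum misses the mean over the line through \<open>b\<close> by the mean
  over the line through \<open>b + n\<close>, which is at most \<open>2 M n\<close>. Convergence of the series, possibly only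
  conditional, is part of the conclusion.\<close>

lemma alternating_series_sums_sech_mean:
  fixes M :: "nat \<Rightarrow> real"
  assumes g: "g holomorphic_on {w. Re w > 0}" and b: "Re b > 0"
    and bd: "\<And>n w. Re w \<ge> Re b + real n \<Longrightarrow> norm (g w) \<le> M n"
    and M: "M \<longlonglongrightarrow> 0"
  shows "(\<lambda>k. (-1) ^ k * g (b + 1/2 + of_nat k)) sums sech_mean g b"
proof -
  have cont: "continuous_on {w. Re w > 0} g"
    using g by (rule holomorphic_on_imp_continuous_on)
  have partial: "(\<Sum>k<n. (-1) ^ k * g (b + 1/2 + of_nat k)) = sech_mean g b - (-1) ^ n * sech_mean g (b + of_nat n)" for n
  proof (induction n)
    case (Suc n)
    have "sech_mean g (b + of_nat n) + sech_mean g (b + of_nat n + 1) = g (b + of_nat n + 1/2)"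
      using b by (intro sech_mean_shift[OF g, where K = "M 0"] bd) auto
    then have "g (b + 1/2 + of_nat n) = sech_mean g (b + of_nat n) + sech_mean g (b + of_nat (Suc n))"
      by (simp add: add_ac)
    then show ?case
      by (simp only: sum.lessThan_Suc Suc.IH) (simp add: algebra_simps)
  qed auto
  have "(\<lambda>n. (-1) ^ n * sech_mean g (b + of_nat n)) \<longlonglongrightarrow> 0"
  proof (rule Lim_null_comparison[OF always_eventually])
    have "norm (sech_mean g (b + of_nat n)) \<le> 2 * M n" for n
      using b by (intro norm_sech_mean_le[OF cont] bd) auto
    then show "\<forall>n. norm ((-1) ^ n * sech_mean g (b + of_nat n)) \<le> 2 * M n"
      by (simp add: norm_mult norm_power)
    show "(\<lambda>n. 2 * M n) \<longlonglongrightarrow> 0"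
      using tendsto_mult_right_zero[OF M] by simp
  qed
  from tendsto_diff[OF tendsto_const this, of "sech_mean g b"] show ?thesis
    by (simp add: sums_def partial)
qed

section \<open>The alternating Hurwitz zeta function as a secant mean\<close>

lemma norm_powr_minus_le:
  fixes w s :: complex
  assumes "w \<noteq> 0"
  shows "norm (w powr (- s)) \<le> norm w powr (- Re s) * exp (pi * norm s)"
proof -
  have "Im s * Arg w \<le> \<bar>Im s\<bar> * \<bar>Arg w\<bar>"
    by (metis abs_ge_self abs_mult)
  also have "\<dots> \<le> norm s * pi"
    using Arg_le_pi[of w] mpi_less_Arg[of w] by (intro mult_mono abs_Im_le_cmod) auto
  finally have "exp (Im s * Arg w) \<le> exp (pi * norm s)"
    by (simp add: mult.commute)
  then show ?thesis
    by (simp add: norm_powr_complex mult_left_mono)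
qed

text \<open>For \<open>r = |w|\<close>, either sign of \<open>Re s\<close> is covered by \<open>r\<^sup>m\<close> if \<open>r \<ge> 1\<close> and by \<open>r\<^sup>-\<^sup>m\<close> if \<open>r < 1\<close>. The former is at most
  \<open>m! exp r\<close>, by the exponential series. The bound is uniform in \<open>s\<close>, as analyticity in \<open>s\<close> requires.\<close>

lemma powr_neg_exponential_growth:
  fixes w s :: complex
  assumes \<beta>: "0 < \<beta>" "\<beta> \<le> norm w" and w: "norm w \<le> c + v" and s: "norm s \<le> real m"
  shows "norm (w powr (- s)) \<le> ((1/\<beta>) ^ m + fact m * exp c) * exp (pi * real m) * exp \<bar>v\<bar>"
proof -
  define r where "r = norm w"
  have r: "r > 0" "\<beta> \<le> r" "r \<le> c + v"
    using assms by (auto simp: r_def)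
  have Re_s: "- Re s \<le> real m" "- real m \<le> - Re s"
    using abs_Re_le_cmod[of s] s by auto
  have e1: "1 \<le> exp \<bar>v\<bar>"
    by simp
  have "r powr (- Re s) \<le> ((1/\<beta>) ^ m + fact m * exp c) * exp \<bar>v\<bar>"
  proof (cases "r \<ge> 1")
    case True
    have "r powr (- Re s) \<le> r ^ m"
      using powr_mono[OF Re_s(1) True] r by (simp add: powr_realpow)
    also have "\<dots> = fact m * (r ^ m / fact m)"
      by simp
    also have "r ^ m / fact m \<le> exp r"
    proof -
      have "r ^ m /\<^sub>R fact m \<le> (\<Sum>n. r ^ n /\<^sub>R fact n)"
        using sum_le_suminf[OF summable_exp_generic[of r], of "{m}"] r by simp
      then show ?thesis
        by (simp add: exp_def divide_inverse mult.commute)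
    qed
    also have "exp r \<le> exp c * exp \<bar>v\<bar>"
      using r by (simp flip: exp_add)
    finally have "r powr (- Re s) \<le> fact m * exp c * exp \<bar>v\<bar>"
      by (simp add: mult_ac)
    moreover have "0 \<le> (1/\<beta>) ^ m * exp \<bar>v\<bar>"
      using \<beta> by simp
    ultimately show ?thesis
      by (simp add: algebra_simps)
  next
    case False
    have "r powr (- Re s) \<le> r powr (- real m)"
      using Re_s False r by (intro powr_mono') auto
    also have "\<dots> = (1 / r) ^ m"
      using r by (simp add: powr_minus powr_realpow power_one_over inverse_eq_divide)
    also have "\<dots> \<le> (1 / \<beta>) ^ m"
      using r \<beta> by (intro power_mono frac_le) auto
    also have "\<dots> \<le> (1/\<beta>) ^ m + fact m * exp c"
      by simp
    also have "\<dots> \<le> ((1/\<beta>) ^ m + fact m * exp c) * exp \<bar>v\<bar>"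
      using mult_left_mono[OF e1, of "(1/\<beta>) ^ m + fact m * exp c"] \<beta> by simp
    finally show ?thesis .
  qed
  then have "r powr (- Re s) * exp (pi * norm s)
      \<le> (((1/\<beta>) ^ m + fact m * exp c) * exp \<bar>v\<bar>) * exp (pi * real m)"
    using s \<beta> by (intro mult_mono) auto
  moreover have "norm (w powr (- s)) \<le> r powr (- Re s) * exp (pi * norm s)"
    unfolding r_def using \<beta> by (intro norm_powr_minus_le) auto
  ultimately show ?thesis
    by (simp add: mult_ac)
qed

lemma powr_on_vertical_line_bound:
  assumes b: "Re b > 0"
  obtains K where "\<And>s w. norm s \<le> real m \<Longrightarrow> Re w = Re b \<Longrightarrow> norm (w powr (- s)) \<le> K * exp (2 * norm (w - b))"
proof
  fix s w :: complex
  assume s: "norm s \<le> real m" and w: "Re w = Re b"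
  define K where "K = ((1/Re b) ^ m + fact m * exp (norm b)) * exp (pi * real m)"
  have "norm (w powr (- s)) \<le> K * exp \<bar>norm (w - b)\<bar>"
    unfolding K_def using b w s complex_Re_le_cmod[of w] norm_triangle_sub[of w b]
    by (intro powr_neg_exponential_growth) auto
  also have "\<dots> \<le> K * exp (2 * norm (w - b))"
    using b by (intro mult_left_mono) (auto simp: K_def)
  finally show "norm (w powr (- s)) \<le> K * exp (2 * norm (w - b))" .
qed

lemma holomorphic_powr_halfplane: "(\<lambda>w. w powr s) holomorphic_on {w. Re w > 0}"
  by (auto intro!: holomorphic_intros simp: complex_nonpos_Reals_iff)

lemma continuous_powr_halfplane: "continuous_on {w. Re w > 0} (\<lambda>w. w powr (s::complex))"
  by (intro holomorphic_on_imp_continuous_on holomorphic_powr_halfplane)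

lemma sech_powr_truncated_holomorphic:
  assumes b: "Re b > 0"
  shows "(\<lambda>s. integral {0..T} (sech_integrand (\<lambda>w. w powr (- s)) b)) holomorphic_on UNIV"
proof -
  define L1 L2 where "L1 = (\<lambda>v. Ln (b + \<i> * of_real v))" and "L2 = (\<lambda>v. Ln (b - \<i> * of_real v))"
  have nz: "b + \<i> * of_real v \<noteq> 0" "b - \<i> * of_real v \<noteq> 0" for v
    using b by (auto simp: complex_eq_iff)
  have eq: "sech_integrand (\<lambda>w. w powr (- s)) b
      = (\<lambda>v. (exp (- s * L1 v) + exp (- s * L2 v)) / of_real (cosh (pi * v)))" for s
    using nz by (auto simp: sech_integrand_def powr_def L1_def L2_def)
  have cont: "continuous_on (UNIV \<times> X) (\<lambda>z. L1 (snd z))" "continuous_on (UNIV \<times> X) (\<lambda>z. L2 (snd z))"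
    for X :: "real set"
    unfolding L1_def L2_def using b by (auto intro!: continuous_intros simp: complex_nonpos_Reals_iff)
  have "(\<lambda>s. integral (cbox 0 T) (sech_integrand (\<lambda>w. w powr (- s)) b)) holomorphic_on UNIV"
  proof (rule leibniz_rule_holomorphic)
    show "((\<lambda>s. sech_integrand (\<lambda>w. w powr (- s)) b v) has_field_derivative
        (- L1 v * exp (- s * L1 v) - L2 v * exp (- s * L2 v)) / of_real (cosh (pi * v))) (at s within UNIV)" for s v
      unfolding eq by (auto intro!: derivative_eq_intros)
    show "sech_integrand (\<lambda>w. w powr (- s)) b integrable_on cbox 0 T" for s
      by (intro integrable_continuous continuous_on_sech_integrand continuous_powr_halfplane b)
    show "continuous_on (UNIV \<times> cbox 0 T)
        (\<lambda>(s, v). (- L1 v * exp (- s * L1 v) - L2 v * exp (- s * L2 v)) / of_real (cosh (pi * v)))"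
      unfolding case_prod_unfold by (intro continuous_intros cont) auto
  qed auto
  then show ?thesis
    by simp
qed

text \<open>The truncated integrals are entire by differentiation under the integral sign, and they converge uniformly on
  the unit disc about any point.\<close>

lemma sech_mean_powr_entire:
  assumes b: "Re b > 0"
  shows "(\<lambda>s. sech_mean (\<lambda>w. w powr (- s)) b) holomorphic_on UNIV"
proof -
  define I where "I = (\<lambda>s. integral {0..} (sech_integrand (\<lambda>w. w powr (- s)) b))"
  define J where "J = (\<lambda>n s. integral {0..real n} (sech_integrand (\<lambda>w. w powr (- s)) b))"
  have "I holomorphic_on UNIV"
  proof (rule holomorphic_uniform_sequence)
    show "J n holomorphic_on UNIV" for n
      unfolding J_def by (rule sech_powr_truncated_holomorphic[OF b])
    fix s0 :: complex
    obtain m :: nat where m: "norm s0 + 1 \<le> real m"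
      using real_arch_simple by blast
    obtain K where K: "\<And>s w. norm s \<le> real m \<Longrightarrow> Re w = Re b \<Longrightarrow> norm (w powr (- s)) \<le> K * exp (2 * norm (w - b))"
      using powr_on_vertical_line_bound[OF b, where m = m] by blast
    have bound: "norm (J n s - I s) \<le> 4 * K * exp (- real n)" if "s \<in> cball s0 1" for n s
    proof -
      have "norm s \<le> real m"
        using that m norm_triangle_sub[of s s0] by (auto simp: dist_norm norm_minus_commute)
      from sech_integrand_integrable(2)[OF continuous_powr_halfplane b K[OF this], of "real n"]
      show ?thesis
        by (simp add: I_def J_def norm_minus_commute)
    qed
    have lim: "(\<lambda>n. 4 * K * exp (- real n)) \<longlonglongrightarrow> 0"
      by real_asymp
    have "uniform_limit (cball s0 1) J I sequentially"
    proof (rule uniform_limitI)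
      fix e :: real
      assume "e > 0"
      with lim have "\<forall>\<^sub>F n in sequentially. 4 * K * exp (- real n) < e"
        by (rule order_tendstoD(2))
      then show "\<forall>\<^sub>F n in sequentially. \<forall>s\<in>cball s0 1. dist (J n s) (I s) < e"
      proof eventually_elim
        case (elim n)
        then show ?case
          using order_le_less_trans[OF bound elim] by (auto simp: dist_norm)
      qed
    qed
    then show "\<exists>d. 0 < d \<and> cball s0 d \<subseteq> UNIV \<and> uniform_limit (cball s0 d) J I sequentially"
      by (intro exI[of _ 1]) auto
  qed auto
  then show ?thesis
    unfolding sech_mean_def I_def by (intro holomorphic_intros) auto
qed

lemma sech_mean_powr_sums:
  assumes b: "Re b > 0" and s: "Re s > 0"
  shows "(\<lambda>k. (-1) ^ k / (of_nat k + (b + 1/2)) powr s) sums sech_mean (\<lambda>w. w powr (- s)) b"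
proof -
  have "(\<lambda>k. (-1) ^ k * (b + 1/2 + of_nat k) powr (- s)) sums sech_mean (\<lambda>w. w powr (- s)) b"
  proof (rule alternating_series_sums_sech_mean[OF holomorphic_powr_halfplane b])
    fix n :: nat and w :: complex
    assume w: "Re w \<ge> Re b + real n"
    have nw: "Re b + real n \<le> norm w"
      using w complex_Re_le_cmod[of w] by linarith
    have "norm (w powr (- s)) \<le> norm w powr (- Re s) * exp (pi * norm s)"
      using nw b by (intro norm_powr_minus_le) auto
    also have "norm w powr (- Re s) \<le> (Re b + real n) powr (- Re s)"
      using nw b s by (intro powr_mono2') auto
    finally show "norm (w powr (- s)) \<le> (Re b + real n) powr (- Re s) * exp (pi * norm s)"
      by simp
  next
    show "(\<lambda>n. (Re b + real n) powr (- Re s) * exp (pi * norm s)) \<longlonglongrightarrow> 0"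
      using s by real_asymp
  qed
  moreover have "(-1) ^ k * (b + 1/2 + of_nat k) powr (- s) = (-1) ^ k / (of_nat k + (b + 1/2)) powr s" for k
    by (simp only: powr_minus_divide add.commute[of "of_nat k"]) simp
  ultimately show ?thesis
    by simp
qed

text \<open>The mean is entire in \<open>s\<close> and sums the series for \<open>Re s > 0\<close>; by the identity theorem it is the only such
  function, hence the one that the definite description denotes.\<close>

lemma alt_hurwitz_zeta_eq_sech_mean:
  assumes b: "Re b > 0"
  shows "alt_hurwitz_zeta s (b + 1/2) = sech_mean (\<lambda>w. w powr (- s)) b"
proof -
  define E where "E = (\<lambda>s. sech_mean (\<lambda>w. w powr (- s)) b)"
  have E: "E holomorphic_on UNIV"
    unfolding E_def by (rule sech_mean_powr_entire[OF b])
  have sums: "(\<lambda>k. (-1) ^ k / (of_nat k + (b + 1/2)) powr z) sums E z" if "Re z > 0" for z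
    unfolding E_def by (rule sech_mean_powr_sums[OF b that])
  have "(THE f. f holomorphic_on UNIV \<and>
        (\<forall>z. Re z > 0 \<longrightarrow> (\<lambda>k. (-1) ^ k / (of_nat k + (b + 1/2)) powr z) sums f z)) = E"
  proof (rule the_equality)
    fix f
    assume f: "f holomorphic_on UNIV \<and>
        (\<forall>z. Re z > 0 \<longrightarrow> (\<lambda>k. (-1) ^ k / (of_nat k + (b + 1/2)) powr z) sums f z)"
    show "f = E"
    proof
      fix z
      show "f z = E z"
      proof (rule analytic_continuation_open[where s = "{z. Re z > 0}" and s' = UNIV and f = f and g = E])
        show "{z. Re z > 0} \<noteq> {}"
          by (auto intro!: exI[of _ 1])
        show "f z = E z" if "z \<in> {z. Re z > 0}" for z
          using sums_unique2 sums f that by blast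
      qed (use f E in \<open>auto simp: open_halfspace_Re_gt\<close>)
    qed
  qed (use E sums in auto)
  then show ?thesis
    by (simp add: alt_hurwitz_zeta_def E_def)
qed

section \<open>The integral\<close>

text \<open>With \<open>p, m = a/2 \<plusminus> iv\<close>, the logarithms of \<open>m/p\<close> and \<open>mp\<close> split without a multiple of \<open>2\<pi>i\<close>, since both arguments
  are less than \<open>\<pi>/2\<close> in modulus. Euler's formula then gives two exponentials, in each of which one of
  \<open>Ln m\<close> and \<open>Ln p\<close> cancels against the denominator.\<close>

lemma sin_Arctan_over_powr:
  fixes a s :: complex and v :: real
  assumes a: "Re a > 0"
  shows "sin (s * Arctan (2 * of_real v / a)) / (a\<^sup>2 + 4 * (of_real v)\<^sup>2) powr (s / 2)
      = ((a / 2 - \<i> * of_real v) powr (- s) - (a / 2 + \<i> * of_real v) powr (- s)) / (2 * \<i> * 2 powr s)"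
proof -
  define p m where "p = a / 2 + \<i> * of_real v" and "m = a / 2 - \<i> * of_real v"
  have pos: "Re p > 0" "Re m > 0"
    using a by (auto simp: p_def m_def)
  then have nz: "p \<noteq> 0" "m \<noteq> 0" "a \<noteq> 0"
    using a by auto
  have Im: "\<bar>Im (Ln p)\<bar> < pi / 2" "\<bar>Im (Ln m)\<bar> < pi / 2"
    using pos nz Re_Ln_pos_lt by blast+
  have "Ln (m / p) = Ln m - Ln p"
    using Im nz by (intro Ln_unique) (auto simp: exp_diff)
  moreover have "(1 - \<i> * (2 * of_real v / a)) / (1 + \<i> * (2 * of_real v / a)) = m / p"
  proof -
    have "m = a / 2 * (1 - \<i> * (2 * of_real v / a))" "p = a / 2 * (1 + \<i> * (2 * of_real v / a))"
      using nz by (simp_all add: m_def p_def field_simps)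
    then have "m / p = (a / 2 * (1 - \<i> * (2 * of_real v / a))) / (a / 2 * (1 + \<i> * (2 * of_real v / a)))"
      by (rule arg_cong2)
    also have "\<dots> = (1 - \<i> * (2 * of_real v / a)) / (1 + \<i> * (2 * of_real v / a))"
      using nz by (intro mult_divide_mult_cancel_left) auto
    finally show ?thesis
      by (rule sym)
  qed
  ultimately have arctan: "Arctan (2 * of_real v / a) = \<i> / 2 * (Ln m - Ln p)"
    by (simp add: Arctan_def)
  have Ln_mp: "Ln (m * p) = Ln m + Ln p"
    using Im nz by (intro Ln_times_simple) auto
  have prod: "a\<^sup>2 + 4 * (of_real v)\<^sup>2 = of_real 4 * (m * p)"
    by (simp add: m_def p_def power2_eq_square algebra_simps)
  have "Ln (of_real 4) = 2 * Ln 2"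
    using ln_realpow[of 2 2] Ln_of_real[of 4] Ln_of_real[of 2] by simp
  then have "Ln (a\<^sup>2 + 4 * (of_real v)\<^sup>2) = 2 * Ln 2 + (Ln m + Ln p)"
    unfolding prod using nz Ln_mp by (subst Ln_times_of_real) auto
  moreover have "a\<^sup>2 + 4 * (of_real v)\<^sup>2 \<noteq> 0"
    unfolding prod using nz by simp
  ultimately have "(a\<^sup>2 + 4 * (of_real v)\<^sup>2) powr (s / 2) = exp (s / 2 * (2 * Ln 2 + (Ln m + Ln p)))"
    by (simp add: powr_def)
  also have "\<dots> = 2 powr s * exp (s / 2 * (Ln m + Ln p))"
    by (simp add: powr_def algebra_simps add_divide_distrib flip: exp_add)
  finally have pw: "(a\<^sup>2 + 4 * (of_real v)\<^sup>2) powr (s / 2) = 2 powr s * exp (s / 2 * (Ln m + Ln p))" .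
  have "sin (s * Arctan (2 * of_real v / a)) = (exp (- s / 2 * (Ln m - Ln p)) - exp (s / 2 * (Ln m - Ln p))) / (2 * \<i>)"
  proof -
    have "\<i> * (s * Arctan (2 * of_real v / a)) = (\<i> * \<i>) * (s / 2 * (Ln m - Ln p))"
      unfolding arctan by (simp only: times_divide_eq_left times_divide_eq_right mult_ac)
    then have "\<i> * (s * Arctan (2 * of_real v / a)) = - (s / 2 * (Ln m - Ln p))"
      by simp
    then show ?thesis
      unfolding sin_exp_eq by simp
  qed
  also have "- s / 2 * (Ln m - Ln p) = - s * Ln m + s / 2 * (Ln m + Ln p)"
    by (simp add: field_simps)
  also have "s / 2 * (Ln m - Ln p) = - s * Ln p + s / 2 * (Ln m + Ln p)"
    by (simp add: field_simps)
  also have "exp (- s * Ln m + s / 2 * (Ln m + Ln p)) = m powr (- s) * exp (s / 2 * (Ln m + Ln p))"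
    by (simp only: powr_def exp_add nz if_False)
  also have "exp (- s * Ln p + s / 2 * (Ln m + Ln p)) = p powr (- s) * exp (s / 2 * (Ln m + Ln p))"
    by (simp only: powr_def exp_add nz if_False)
  finally show ?thesis
    unfolding pw p_def[symmetric] m_def[symmetric] by (simp add: field_simps)
qed

text \<open>The integer shifts \<open>s - j\<close> of the exponent multiply \<open>w\<^sup>-\<^sup>s\<close> by \<open>w\<^sup>j\<close>, so the binomial theorem applies.\<close>

lemma binomial_powr_sum:
  fixes b w s :: complex
  assumes "b \<noteq> 0" "w \<noteq> 0"
  shows "(\<Sum>j=0..m. of_nat (m choose j) * (- 1 / b) ^ j * w powr (- (s - of_nat j))) = (1 - w / b) ^ m * w powr (- s)"
proof -
  have "w powr (- (s - of_nat j)) = w ^ j * w powr (- s)" for j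
    using assms by (simp add: powr_def left_diff_distrib exp_diff exp_minus exp_of_nat_mult divide_inverse)
  then have "(\<Sum>j=0..m. of_nat (m choose j) * (- 1 / b) ^ j * w powr (- (s - of_nat j)))
      = (\<Sum>j\<le>m. of_nat (m choose j) * (- w / b) ^ j * 1 ^ (m - j)) * w powr (- s)"
  proof -
    have "(- w / b) ^ j = (- 1 / b) ^ j * w ^ j" for j
      by (simp flip: power_mult_distrib)
    with \<open>\<And>j. w powr (- (s - of_nat j)) = w ^ j * w powr (- s)\<close> show ?thesis
      by (simp only: sum_distrib_right atMost_atLeast0 mult.assoc power_one mult_1)
  qed
  also have "\<dots> = (- w / b + 1) ^ m * w powr (- s)"
    by (subst binomial_ring) simp
  finally show ?thesis
    by (simp add: algebra_simps)
qed

theorem theorem1: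
  fixes n :: nat and s a q :: complex
  assumes "Re a > 0" and "q = a / 4 + 1 / 4"
  shows "((\<lambda>v::real. of_real v ^ (2 * n + 1) * sin (s * Arctan (2 * of_real v / a)) /
             ((a\<^sup>2 + 4 * (of_real v)\<^sup>2) powr (s / 2) * cosh (of_real (pi * v))))
          has_integral
            ((-1) ^ (n + 1) * (a / 2) ^ (2 * n + 1) * Gamma (of_nat (2 * n + 2)) / 2 powr s *
             (\<Sum>j = 0..2 * n + 1. (- 2 / a) ^ j * alt_hurwitz_zeta (s - of_nat j) (2 * q) /
                (Gamma (2 * of_nat n - of_nat j + 2) * Gamma (of_nat j + 1)))))
         {0..}"
proof -
  define b where "b = a / 2"
  define m where "m = 2 * n + 1"
  \<comment> \<open>The factor \<open>1/2\<close> compensates that the half-line integral of \<open>sech_integrand\<close> is twice the mean.\<close>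
  define C where "C = (-1) ^ (n + 1) * b ^ m / (2 * 2 powr s)"
  define c where "c = (\<lambda>j. of_nat (m choose j) * (- 1 / b) ^ j)"
  have b: "Re b > 0" "b \<noteq> 0"
    using assms(1) by (auto simp: b_def)
  have q: "2 * q = b + 1/2"
    by (simp add: assms(2) b_def)
  have int: "(sech_integrand (\<lambda>w. w powr (- z)) b has_integral 2 * alt_hurwitz_zeta z (2 * q)) {0..}" for z
  proof -
    obtain k :: nat where "norm z \<le> real k"
      using real_arch_simple by blast
    moreover obtain K where "\<And>s w. norm s \<le> real k \<Longrightarrow> Re w = Re b \<Longrightarrow> norm (w powr (- s)) \<le> K * exp (2 * norm (w - b))"
      using powr_on_vertical_line_bound[OF b(1), where m = k] by blast
    ultimately have "sech_integrand (\<lambda>w. w powr (- z)) b integrable_on {0..}"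
      by (intro sech_integrand_integrable(1)[OF continuous_powr_halfplane b(1)])
    then show ?thesis
      by (simp add: q alt_hurwitz_zeta_eq_sech_mean[OF b(1)] sech_mean_def integrable_integral)
  qed
  have "((\<lambda>v. C * (\<Sum>j=0..m. c j * sech_integrand (\<lambda>w. w powr (- (s - of_nat j))) b v)) has_integral
      C * (\<Sum>j=0..m. c j * (2 * alt_hurwitz_zeta (s - of_nat j) (2 * q)))) {0..}"
    by (intro has_integral_mult_right has_integral_sum int) auto
  moreover have "C * (\<Sum>j=0..m. c j * sech_integrand (\<lambda>w. w powr (- (s - of_nat j))) b v)
      = of_real v ^ (2 * n + 1) * sin (s * Arctan (2 * of_real v / a)) /
             ((a\<^sup>2 + 4 * (of_real v)\<^sup>2) powr (s / 2) * cosh (of_real (pi * v)))" for v :: real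
  proof -
    define x where "x = \<i> * complex_of_real v"
    have nz: "b + x \<noteq> 0" "b - x \<noteq> 0"
      using b by (auto simp: complex_eq_iff x_def)
    have "(\<Sum>j=0..m. c j * sech_integrand (\<lambda>w. w powr (- (s - of_nat j))) b v)
        = ((\<Sum>j=0..m. c j * (b + x) powr (- (s - of_nat j))) + (\<Sum>j=0..m. c j * (b - x) powr (- (s - of_nat j))))
            / of_real (cosh (pi * v))"
      by (simp add: sech_integrand_def x_def sum_divide_distrib sum.distrib algebra_simps add_divide_distrib)
    also have "\<dots> = ((1 - (b + x) / b) ^ m * (b + x) powr (- s) + (1 - (b - x) / b) ^ m * (b - x) powr (- s))
            / of_real (cosh (pi * v))"
      unfolding c_def using b nz by (simp only: binomial_powr_sum[OF b(2) nz(1)] binomial_powr_sum[OF b(2) nz(2)])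
    also have "1 - (b + x) / b = - (x / b)"
      using b by (simp add: field_simps)
    also have "1 - (b - x) / b = x / b"
      using b by (simp add: field_simps)
    also have "(- (x / b)) ^ m = - ((x / b) ^ m)"
      by (simp add: m_def)
    finally have "C * (\<Sum>j=0..m. c j * sech_integrand (\<lambda>w. w powr (- (s - of_nat j))) b v)
        = C * (x / b) ^ m * ((b - x) powr (- s) - (b + x) powr (- s)) / of_real (cosh (pi * v))"
      by (simp add: algebra_simps)
    also have "C * (x / b) ^ m = (-1) ^ (n + 1) * x ^ m / (2 * 2 powr s)"
      using b by (simp add: C_def power_divide)
    also have "x ^ m = (-1) ^ n * \<i> * of_real v ^ m"
    proof -
      have "x ^ m = x * (x\<^sup>2) ^ n"
        by (simp add: m_def power_mult)
      also have "x\<^sup>2 = (-1) * (of_real v)\<^sup>2"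
        by (simp add: x_def power_mult_distrib)
      also have "x * ((-1) * (of_real v)\<^sup>2) ^ n = (-1) ^ n * \<i> * of_real v ^ m"
        by (simp only: power_mult_distrib x_def m_def) (simp add: power_mult)
      finally show ?thesis .
    qed
    also have "(-1) ^ (n + 1) * ((-1) ^ n * \<i> * of_real v ^ m) / (2 * 2 powr s) = of_real v ^ m / (2 * \<i> * 2 powr s)"
      by (simp add: field_simps flip: power_add)
    also have "of_real v ^ m / (2 * \<i> * 2 powr s) * ((b - x) powr (- s) - (b + x) powr (- s)) / of_real (cosh (pi * v))
        = of_real v ^ m * (((b - x) powr (- s) - (b + x) powr (- s)) / (2 * \<i> * 2 powr s)) / of_real (cosh (pi * v))"
      by simp
    also have "((b - x) powr (- s) - (b + x) powr (- s)) / (2 * \<i> * 2 powr s)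
        = sin (s * Arctan (2 * of_real v / a)) / (a\<^sup>2 + 4 * (of_real v)\<^sup>2) powr (s / 2)"
      unfolding sin_Arctan_over_powr[OF assms(1)] by (simp only: b_def x_def)
    finally show ?thesis
      by (simp only: m_def cosh_complex_of_real) simp
  qed
  moreover have "C * (\<Sum>j=0..m. c j * (2 * alt_hurwitz_zeta (s - of_nat j) (2 * q)))
     = (-1) ^ (n + 1) * (a / 2) ^ (2 * n + 1) * Gamma (of_nat (2 * n + 2)) / 2 powr s *
             (\<Sum>j = 0..2 * n + 1. (- 2 / a) ^ j * alt_hurwitz_zeta (s - of_nat j) (2 * q) /
                (Gamma (2 * of_nat n - of_nat j + 2) * Gamma (of_nat j + 1)))"
  proof -
    have Gm: "Gamma (of_nat (2 * n + 2)) = (fact m :: complex)"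
      using Gamma_fact[of m, where 'a = complex] by (simp add: m_def add_ac)
    have "c j * (2 * alt_hurwitz_zeta (s - of_nat j) (2 * q))
        = 2 * fact m * ((- 2 / a) ^ j * alt_hurwitz_zeta (s - of_nat j) (2 * q) /
                (Gamma (2 * of_nat n - of_nat j + 2) * Gamma (of_nat j + 1)))" if "j \<in> {0..m}" for j
    proof -
      have j: "j \<le> m"
        using that by simp
      have "2 * of_nat n - of_nat j + 2 = (1 + of_nat (m - j) :: complex)"
        using j by (simp add: m_def of_nat_diff)
      then have "Gamma (2 * of_nat n - of_nat j + 2) = (fact (m - j) :: complex)"
        by (simp only: Gamma_fact)
      moreover have "Gamma (of_nat j + 1) = (fact j :: complex)"
        using Gamma_fact[of j, where 'a = complex] by (simp add: add.commute)
      moreover have "- 1 / b = - 2 / a"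
        by (simp add: b_def)
      ultimately show ?thesis
        unfolding c_def binomial_fact[OF j, where 'a = complex] by (simp add: mult_ac)
    qed
    then have "(\<Sum>j=0..m. c j * (2 * alt_hurwitz_zeta (s - of_nat j) (2 * q)))
        = 2 * fact m * (\<Sum>j=0..m. (- 2 / a) ^ j * alt_hurwitz_zeta (s - of_nat j) (2 * q) /
                (Gamma (2 * of_nat n - of_nat j + 2) * Gamma (of_nat j + 1)))"
      unfolding sum_distrib_left by (rule sum.cong[OF refl])
    then show ?thesis
      unfolding Gm by (simp add: C_def m_def b_def)
  qed
  ultimately show ?thesis
    by simp
qed

end
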